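(* For all integers $n\ge 2$ and $1\le\alpha\le k\le n$ there exists a sequence of queries $Q_1,\dots,Q_t\subseteq N=\{1,\dots,n\}$ of length $$t=O\left(\min\left\{n,\ \left(k + \frac{n}{\alpha} \right)\log n\right\}\right)$$ that solves Group Testing for hidden sets of size at most $k$ under the feedback $F_\alpha(X)=\min\{|X|,\alpha\}$. The constant hidden in $O(\cdot)$ is absolute.
   Context: Let $N=\{1,\dots,n\}$. For $\alpha\in\{1,\dots,k\}$, the $\alpha$-capped quantitative feedback is $F_\alpha(X)=\min\{|X|,\alpha\}$ for $X\subseteq N$. A fixed (non-adaptive) sequence of queries $Q_1,\dots,Q_t\subseteq N$ solves Group Testing (for parameter $k$) under feedback $F_\alpha$ if for any two different sets $K_1,K_2\subseteq N$ with $|K_1|,|K_2|\le k$ the feedback vectors $\langle F_\alpha(Q_1\cap K_1),\dots,F_\alpha(Q_t\cap K_1)\rangle$ and $\langle F_\alpha(Q_1\cap K_2),\dots,F_\alpha(Q_t\cap K_2)\rangle$ are different. *)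

theory Defs
  imports Complex_Main
begin

definition capped_feedback :: "nat \<Rightarrow> nat set \<Rightarrow> nat" where
  "capped_feedback \<alpha> X = min (card X) \<alpha>"

definition feedback_vector :: "nat \<Rightarrow> nat set list \<Rightarrow> nat set \<Rightarrow> nat list" where
  "feedback_vector \<alpha> Qs K = map (\<lambda>Q. capped_feedback \<alpha> (Q \<inter> K)) Qs"

definition solves_group_testing :: "nat \<Rightarrow> nat \<Rightarrow> nat \<Rightarrow> nat set list \<Rightarrow> bool" where
  "solves_group_testing n k \<alpha> Qs \<longleftrightarrow>
    (\<forall>K\<^sub>1 K\<^sub>2. K\<^sub>1 \<subseteq> {1..n} \<and> K\<^sub>2 \<subseteq> {1..n} \<and> card K\<^sub>1 \<le> k \<and> card K\<^sub>2 \<le> k \<and> K\<^sub>1 \<noteq> K\<^sub>2 \<longrightarrow>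
      feedback_vector \<alpha> Qs K\<^sub>1 \<noteq> feedback_vector \<alpha> Qs K\<^sub>2)"

end

theory Submission
  imports Defs
begin

text \<open>A query with at most \<open>\<alpha>\<close> elements is answered exactly, so it separates \<open>K\<^sub>1\<close> from
  \<open>K\<^sub>2\<close> iff it meets \<open>A = K\<^sub>1 - K\<^sub>2\<close> and \<open>B = K\<^sub>2 - K\<^sub>1\<close> in different numbers of elements. Take a random
  such query: \<open>\<alpha>\<close> independent uniform samples, intersected with a uniform random subset of the
  ground set. If the samples hit \<open>A \<union> B\<close>, toggling a hit element in the random subset shows that
  the query separates with probability at least 1/2. With \<open>d = card (A \<union> B)\<close>, \<open>t\<close> independent
  queries thus all fail with probability at most \<open>((1 + (1 - d/n)^\<alpha>) / 2)^t\<close>. There are at most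
  \<open>(2n)^d\<close> pairs \<open>(A, B)\<close> of total size \<open>d \<le> 2k\<close>, and for \<open>t\<close> of order \<open>(k + n/\<alpha>) log n\<close> the union
  bound over all of them is less than 1. The bound \<open>n\<close> is attained by the singletons.\<close>

section \<open>Counting the random queries that fail on a pair\<close>

text \<open>Fix one \<open>x\<close> in \<open>S \<inter> (A \<union> B)\<close>. Toggling it is an
  involution on the subsets of \<open>U\<close>; by disjointness it changes exactly one of the two
  counts. So it sends balanced sets injectively to unbalanced ones, and at most half of all subsets
  are balanced.\<close>

lemma card_subsets_balanced_le:
  assumes "finite U" "S \<subseteq> U" "A \<inter> B = {}" "S \<inter> (A \<union> B) \<noteq> {}"
  shows "2 * card {R. R \<subseteq> U \<and> card (S \<inter> R \<inter> A) = card (S \<inter> R \<inter> B)} \<le> 2 ^ card U"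
proof -
  let ?E = "{R. R \<subseteq> U \<and> card (S \<inter> R \<inter> A) = card (S \<inter> R \<inter> B)}"
  obtain x where x: "x \<in> S" "x \<in> A \<union> B" using assms by blast
  define \<tau> where "\<tau> R = (if x \<in> R then R - {x} else insert x R)" for R
  have fS: "finite S" using assms finite_subset by blast
  have same: "card (S \<inter> \<tau> R \<inter> Y) = card (S \<inter> R \<inter> Y)" if "x \<notin> Y" for R Y
    using that by (intro arg_cong[where f=card]) (auto simp: \<tau>_def)
  have diff: "card (S \<inter> \<tau> R \<inter> Y) \<noteq> card (S \<inter> R \<inter> Y)" if "x \<in> Y" for R Y
  proof (cases "x \<in> R")
    case True
    then have "S \<inter> \<tau> R \<inter> Y \<subset> S \<inter> R \<inter> Y" using that x by (auto simp: \<tau>_def)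
    then show ?thesis using fS by (metis finite_Int nat_less_le psubset_card_mono)
  next
    case False
    then have "S \<inter> R \<inter> Y \<subset> S \<inter> \<tau> R \<inter> Y" using that x by (auto simp: \<tau>_def)
    then show ?thesis using fS by (metis finite_Int nat_less_le psubset_card_mono)
  qed
  have disj: "?E \<inter> \<tau> ` ?E = {}"
  proof -
    have False if "R \<in> ?E" "\<tau> R \<in> ?E" for R
    proof (cases "x \<in> A")
      case True
      then have "x \<notin> B" using assms by blast
      then show ?thesis using that same[of B R] diff[OF True, of R] by simp
    next
      case False
      then have "x \<in> B" using x by blast
      then show ?thesis using that same[OF False, of R] diff[of B R] by simp
    qed
    then show ?thesis by blast
  qed
  have "inj \<tau>"
    by (rule inj_on_inverseI[where g=\<tau>]) (auto simp: \<tau>_def)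
  then have "card (\<tau> ` ?E) = card ?E" by (simp add: card_image inj_on_def)
  moreover have fE: "finite ?E" using assms(1) by simp
  ultimately have "2 * card ?E = card (?E \<union> \<tau> ` ?E)"
    using disj by (simp add: card_Un_disjoint)
  also have "\<dots> \<le> card (Pow U)"
    using assms x by (intro card_mono) (auto simp: \<tau>_def)
  finally show ?thesis using assms(1) by (simp add: card_Pow)
qed

text \<open>The failure probability \<open>(1 + (1 - d/n)^a) / 2\<close> in counting form. Sampling
  with repetition makes the number of sample lists that miss \<open>A \<union> B\<close> the exact
  power \<open>(n - d)^a\<close>.\<close>

lemma card_sampled_balanced_le:
  assumes "finite U" "A \<inter> B = {}" "A \<union> B \<subseteq> U"
  shows "2 * card {(xs, R). set xs \<subseteq> U \<and> length xs = a \<and> R \<subseteq> U \<and>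
                     card (set xs \<inter> R \<inter> A) = card (set xs \<inter> R \<inter> B)}
    \<le> 2 ^ card U * (card U ^ a + (card U - card (A \<union> B)) ^ a)"
proof -
  let ?L = "{xs. set xs \<subseteq> U \<and> length xs = a}"
  let ?M = "{xs. set xs \<subseteq> U - (A \<union> B) \<and> length xs = a}"
  let ?E = "\<lambda>xs. {R. R \<subseteq> U \<and> card (set xs \<inter> R \<inter> A) = card (set xs \<inter> R \<inter> B)}"
  have finL: "finite ?L" using assms(1) by (rule finite_lists_length_eq)
  have finE: "finite (?E xs)" for xs using assms(1) by simp
  \<comment> \<open>Lists hitting \<open>A \<union> B\<close> fail for at most half of the sets
    \<open>R\<close>; for a list in \<open>?M\<close> both counts are 0 and every \<open>R\<close>
    fails, whence the second summand.\<close>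
  have bound: "2 * card (?E xs) \<le> 2 ^ card U + (if xs \<in> ?M then 2 ^ card U else 0)"
    if "xs \<in> ?L" for xs
  proof (cases "set xs \<inter> (A \<union> B) = {}")
    case True
    have "card (?E xs) \<le> card (Pow U)" using assms(1) by (intro card_mono) auto
    moreover have "xs \<in> ?M" using True that by auto
    ultimately show ?thesis using assms(1) by (simp add: card_Pow)
  next
    case False
    then show ?thesis using card_subsets_balanced_le[OF assms(1) _ assms(2) False] that by simp
  qed
  have "{(xs, R). set xs \<subseteq> U \<and> length xs = a \<and> R \<subseteq> U \<and>
           card (set xs \<inter> R \<inter> A) = card (set xs \<inter> R \<inter> B)} = Sigma ?L ?E" by auto
  then have "2 * card {(xs, R). set xs \<subseteq> U \<and> length xs = a \<and> R \<subseteq> U \<and>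
        card (set xs \<inter> R \<inter> A) = card (set xs \<inter> R \<inter> B)} = (\<Sum>xs\<in>?L. 2 * card (?E xs))"
    using finL finE by (simp add: sum_distrib_left)
  also have "\<dots> \<le> (\<Sum>xs\<in>?L. 2 ^ card U + (if xs \<in> ?M then 2 ^ card U else 0))"
    by (rule sum_mono) (rule bound)
  also have "\<dots> = card ?L * 2 ^ card U + card (?L \<inter> ?M) * 2 ^ card U"
    by (subst sum.distrib, subst sum.inter_restrict[OF finL, symmetric]) simp
  also have "?L \<inter> ?M = ?M" by auto
  also have "card ?L = card U ^ a" using assms(1) by (rule card_lists_length_eq)
  also have "card ?M = (card U - card (A \<union> B)) ^ a"
    using assms finite_subset[OF assms(3)] by (simp add: card_lists_length_eq card_Diff_subset)
  finally show ?thesis by (simp add: algebra_simps)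
qed

section \<open>Ingredients of the union bound\<close>

text \<open>List \<open>A \<union> B\<close> in any order and tag each entry with the side it
  belongs to. The map \<open>?f\<close> decodes such a list, so there are no more pairs than tagged
  lists of length \<open>d\<close>.\<close>

lemma card_disjoint_pairs_le:
  assumes "finite U"
  shows "card {(A, B). A \<inter> B = {} \<and> A \<union> B \<subseteq> U \<and> card (A \<union> B) = d} \<le> (2 * card U) ^ d"
proof -
  let ?L = "{xs. set xs \<subseteq> U \<times> (UNIV :: bool set) \<and> length xs = d}"
  let ?f = "\<lambda>xs. ({x. (x, True) \<in> set xs}, {x. (x, False) \<in> set xs})"
  have "{(A, B). A \<inter> B = {} \<and> A \<union> B \<subseteq> U \<and> card (A \<union> B) = d} \<subseteq> ?f ` ?L"
  proof clarify
    fix A B assume AB: "A \<inter> B = {}" "A \<union> B \<subseteq> U" "d = card (A \<union> B)"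
    have "finite (A \<union> B)" using AB assms finite_subset by blast
    then obtain ys where ys: "set ys = A \<union> B" "distinct ys" using finite_distinct_list by blast
    let ?xs = "map (\<lambda>x. (x, x \<in> A)) ys"
    have "?f ?xs = (A, B)" using ys AB by auto
    moreover have "?xs \<in> ?L" using ys AB distinct_card[OF ys(2)] by auto
    ultimately show "(A, B) \<in> ?f ` {xs. set xs \<subseteq> U \<times> (UNIV :: bool set) \<and> length xs = card (A \<union> B)}"
      using AB(3) by (intro image_eqI[of _ _ ?xs]) simp_all
  qed
  moreover have fin: "finite ?L" using assms by (intro finite_lists_length_eq) simp
  ultimately have "card {(A, B). A \<inter> B = {} \<and> A \<union> B \<subseteq> U \<and> card (A \<union> B) = d} \<le> card ?L"
    by (meson card_image_le card_mono finite_imageI le_trans)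
  also have "\<dots> = (card U * 2) ^ d"
    using assms by (simp add: card_lists_length_eq card_cartesian_product)
  finally show ?thesis by (simp add: mult.commute)
qed

text \<open>The union bound over \<open>P\<close>, by counting: \<open>card (E p) ^ t\<close> lists
  stay inside the bad event \<open>E p\<close>, and together these are too few to exhaust all lists
  over \<open>\<Omega>\<close>.\<close>

lemma exists_list_avoiding:
  assumes "finite \<Omega>" "finite P" "\<And>p. p \<in> P \<Longrightarrow> E p \<subseteq> \<Omega>"
    and "(\<Sum>p\<in>P. card (E p) ^ t) < card \<Omega> ^ t"
  shows "\<exists>qs. set qs \<subseteq> \<Omega> \<and> length qs = t \<and> (\<forall>p\<in>P. \<not> set qs \<subseteq> E p)"
proof (rule ccontr)
  assume "\<not> ?thesis"
  then have sub: "{qs. set qs \<subseteq> \<Omega> \<and> length qs = t} \<subseteq> (\<Union>p\<in>P. {qs. set qs \<subseteq> E p \<and> length qs = t})"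
    by blast
  have fin: "finite (E p)" if "p \<in> P" for p using that assms finite_subset by blast
  have "card \<Omega> ^ t = card {qs. set qs \<subseteq> \<Omega> \<and> length qs = t}"
    using assms(1) by (simp add: card_lists_length_eq)
  also have "\<dots> \<le> card (\<Union>p\<in>P. {qs. set qs \<subseteq> E p \<and> length qs = t})"
    using sub assms(2) fin by (intro card_mono) (auto intro: finite_lists_length_eq)
  also have "\<dots> \<le> (\<Sum>p\<in>P. card {qs. set qs \<subseteq> E p \<and> length qs = t})"
    using assms(2) by (rule card_UN_le)
  also have "\<dots> = (\<Sum>p\<in>P. card (E p) ^ t)"
    using fin by (intro sum.cong) (simp_all add: card_lists_length_eq)
  finally show False using assms(4) by simp
qed

text \<open>With \<open>x = d/n\<close>, Bernoulli and \<open>(1 - x)^a * (1 + x)^a \<le> 1\<close>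
  give \<open>(1 - x)^a \<le> 1 / (1 + a x)\<close>. The base is then at most
  \<open>1 - a x / (2 (1 + a x))\<close>, which is bounded by an exponential.\<close>

lemma failure_probability_le:
  fixes n a d t :: nat
  assumes "1 \<le> a" "1 \<le> d" "d \<le> n"
    and t: "2 * (real n / real a + real d) * ln (4 * real n) \<le> real t"
  shows "((1 + (1 - real d / real n) ^ a) / 2) ^ t \<le> (1 / (4 * real n)) ^ d"
proof -
  define x where "x = real d / real n"
  have n: "n > 0" using assms by simp
  have x: "0 < x" "x \<le> 1" using assms n by (auto simp: x_def)
  have y: "0 < 1 + real a * x" using x by (simp add: add_pos_nonneg)
  have "(1 - x) ^ a * (1 + real a * x) \<le> (1 - x) ^ a * (1 + x) ^ a"
    using x Bernoulli_inequality[of x a] by (intro mult_left_mono) auto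
  also have "\<dots> = (1 - x\<^sup>2) ^ a"
    by (simp add: power_mult_distrib[symmetric] power2_eq_square algebra_simps)
  also have "\<dots> \<le> 1" using x by (intro power_le_one) (auto simp: power_le_one)
  finally have "(1 - x) ^ a \<le> 1 / (1 + real a * x)" using y by (simp add: field_simps)
  then have "(1 + (1 - x) ^ a) / 2 \<le> 1 - real a * x / (2 * (1 + real a * x))"
    using y by (simp add: field_simps)
  also have "\<dots> \<le> exp (- (real a * x / (2 * (1 + real a * x))))"
    using exp_ge_add_one_self[of "- (real a * x / (2 * (1 + real a * x)))"] by simp
  finally have "((1 + (1 - x) ^ a) / 2) ^ t \<le> exp (- (real a * x / (2 * (1 + real a * x)))) ^ t"
    using x by (intro power_mono) auto
  also have "\<dots> = exp (- (real t * (real a * x / (2 * (1 + real a * x)))))"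
    by (simp add: exp_of_nat_mult[symmetric])
  also have "\<dots> \<le> exp (- (real d * ln (4 * real n)))"
  proof -
    have "real d * ln (4 * real n)
        = 2 * (real n / real a + real d) * ln (4 * real n) * (real a * x / (2 * (1 + real a * x)))"
    proof -
      \<comment> \<open>Since \<open>a x / (1 + a x) = a d / (n + a d)\<close>, the number of
        queries needed per unit of \<open>ln (4 n)\<close> is \<open>2 (n/a + d)\<close>; this is
        the source of both terms in the bound on \<open>t\<close>.\<close>
      have "2 * (real n / real a + real d) * (real a * x / (2 * (1 + real a * x))) = real d"
        using n assms y unfolding x_def by (simp add: divide_simps)
      then show ?thesis by (metis mult.assoc mult.commute)
    qed
    also have "\<dots> \<le> real t * (real a * x / (2 * (1 + real a * x)))"
      using t x y by (intro mult_right_mono) auto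
    finally show ?thesis by simp
  qed
  also have "\<dots> = (1 / (4 * real n)) ^ d"
    using n by (simp add: exp_minus exp_of_nat_mult power_one_over inverse_eq_divide)
  finally show ?thesis by (simp add: x_def)
qed

section \<open>Existence of separating queries\<close>

lemma exists_separating_queries:
  fixes U :: "'a set"
  assumes "finite U" "1 \<le> a" "U \<noteq> {}"
    and t: "2 * (real (card U) / real a + real m) * ln (4 * real (card U)) \<le> real t"
  shows "\<exists>Qs. length Qs = t \<and> (\<forall>Q\<in>set Qs. Q \<subseteq> U \<and> card Q \<le> a) \<and>
    (\<forall>A B. A \<inter> B = {} \<and> A \<union> B \<subseteq> U \<and> A \<union> B \<noteq> {} \<and> card (A \<union> B) \<le> m \<longrightarrow>
       (\<exists>Q\<in>set Qs. card (Q \<inter> A) \<noteq> card (Q \<inter> B)))"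
proof -
  define n where "n = card U"
  have n: "n > 0" using assms by (simp add: n_def card_gt_0_iff)
  \<comment> \<open>\<open>\<Omega>\<close> is the uniform sample space of single queries,
    \<open>E (A, B)\<close> the event that a query fails on the pair, and \<open>P d\<close> the
    pairs of total size \<open>d\<close>.\<close>
  define \<Omega> where "\<Omega> = {xs. set xs \<subseteq> U \<and> length xs = a} \<times> Pow U"
  define E where "E = (\<lambda>(A, B). {(xs, R). set xs \<subseteq> U \<and> length xs = a \<and> R \<subseteq> U \<and>
                     card (set xs \<inter> R \<inter> A) = card (set xs \<inter> R \<inter> B)})"
  define P where "P d = {(A, B). A \<inter> B = {} \<and> A \<union> B \<subseteq> U \<and> card (A \<union> B) = d}" for d
  have fin\<Omega>: "finite \<Omega>" using assms(1) by (simp add: \<Omega>_def finite_lists_length_eq)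
  have card\<Omega>: "card \<Omega> = n ^ a * 2 ^ n"
    using assms(1) by (simp add: \<Omega>_def n_def card_cartesian_product card_lists_length_eq card_Pow)
  have finP: "finite (P d)" for d
    by (rule finite_subset[of _ "Pow U \<times> Pow U"]) (use assms(1) in \<open>auto simp: P_def\<close>)
  have fail: "real (card (E p)) ^ t \<le> real (card \<Omega>) ^ t * (1 / (4 * real n)) ^ d"
    if "p \<in> P d" "1 \<le> d" "d \<le> m" for p d
  proof -
    obtain A B where p: "p = (A, B)" and AB: "A \<inter> B = {}" "A \<union> B \<subseteq> U" "card (A \<union> B) = d"
      using \<open>p \<in> P d\<close> by (auto simp: P_def)
    have dn: "d \<le> n" using AB assms(1) card_mono n_def by metis
    have "2 * card (E p) \<le> 2 ^ n * (n ^ a + (n - d) ^ a)"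
      using card_sampled_balanced_le[OF assms(1) AB(1,2), of a] AB(3) by (simp add: E_def p n_def)
    then have "real (2 * card (E p)) \<le> real (2 ^ n * (n ^ a + (n - d) ^ a))"
      by (rule of_nat_mono)
    then have "real (card (E p)) \<le> 2 ^ n * (real n ^ a + (real n - real d) ^ a) / 2"
      using dn by (simp add: of_nat_diff)
    also have "\<dots> = real (card \<Omega>) * ((1 + (1 - real d / real n) ^ a) / 2)"
    proof -
      have "real n ^ a * (1 - real d / real n) ^ a = (real n - real d) ^ a"
        using n by (simp add: power_mult_distrib[symmetric] right_diff_distrib)
      then show ?thesis by (simp add: card\<Omega> algebra_simps)
    qed
    finally have "real (card (E p)) ^ t \<le> (real (card \<Omega>) * ((1 + (1 - real d / real n) ^ a) / 2)) ^ t"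
      by (intro power_mono) auto
    also have "\<dots> = real (card \<Omega>) ^ t * ((1 + (1 - real d / real n) ^ a) / 2) ^ t"
      by (rule power_mult_distrib)
    also have "\<dots> \<le> real (card \<Omega>) ^ t * (1 / (4 * real n)) ^ d"
    proof (intro mult_left_mono failure_probability_le)
      \<comment> \<open>The required length grows with \<open>d\<close>, so a \<open>t\<close>
        chosen for \<open>m\<close> serves every \<open>d \<le> m\<close>.\<close>
      have "2 * (real n / real a + real d) * ln (4 * real n)
          \<le> 2 * (real n / real a + real m) * ln (4 * real n)"
        using that n by (intro mult_right_mono mult_left_mono add_left_mono) auto
      then show "2 * (real n / real a + real d) * ln (4 * real n) \<le> real t"
        using t by (simp add: n_def)
    qed (use assms that dn in auto)
    finally show ?thesis .
  qed
  have disjP: "P c \<inter> P d = {}" if "c \<noteq> d" for c d using that by (auto simp: P_def)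
  \<comment> \<open>The sum starts at \<open>d = 1\<close> because every query fails on the pair of
    empty sets.\<close>
  have "real (\<Sum>p\<in>(\<Union>d\<in>{1..m}. P d). card (E p) ^ t) = (\<Sum>d\<in>{1..m}. \<Sum>p\<in>P d. real (card (E p)) ^ t)"
    unfolding of_nat_sum of_nat_power using finP disjP by (intro sum.UNION_disjoint) auto
  also have "\<dots> \<le> (\<Sum>d\<in>{1..m}. \<Sum>p\<in>P d. real (card \<Omega>) ^ t * (1 / (4 * real n)) ^ d)"
    by (intro sum_mono fail) auto
  also have "\<dots> = (\<Sum>d\<in>{1..m}. real (card (P d)) * (real (card \<Omega>) ^ t * (1 / (4 * real n)) ^ d))"
    by simp
  also have "\<dots> \<le> (\<Sum>d\<in>{1..m}. (2 * real n) ^ d * (real (card \<Omega>) ^ t * (1 / (4 * real n)) ^ d))"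
  proof (intro sum_mono mult_right_mono)
    fix d
    have "real (card (P d)) \<le> real ((2 * n) ^ d)"
      unfolding P_def n_def by (rule of_nat_mono) (rule card_disjoint_pairs_le[OF assms(1)])
    then show "real (card (P d)) \<le> (2 * real n) ^ d" by simp
  qed auto
  \<comment> \<open>The factor 4 in the logarithm pays off here: \<open>(2 n)^d\<close> pairs
    against \<open>(1 / (4 n))^d\<close> leave \<open>(1 / 2)^d\<close>, whose sum over
    \<open>d \<ge> 1\<close> stays below 1.\<close>
  also have "\<dots> = (\<Sum>d\<in>{1..m}. real (card \<Omega>) ^ t * (1 / 2) ^ d)"
  proof (rule sum.cong[OF refl])
    fix d
    have "(2 * real n) ^ d * (1 / (4 * real n)) ^ d = (2 * real n * (1 / (4 * real n))) ^ d"
      by (rule power_mult_distrib[symmetric])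
    also have "2 * real n * (1 / (4 * real n)) = 1 / 2" using n by simp
    finally show "(2 * real n) ^ d * (real (card \<Omega>) ^ t * (1 / (4 * real n)) ^ d)
        = real (card \<Omega>) ^ t * (1 / 2) ^ d"
      by (subst mult.left_commute) simp
  qed
  also have "\<dots> = real (card \<Omega>) ^ t * (1 - (1 / 2) ^ m)"
  proof -
    have "(\<Sum>d\<in>{1..m}. (1 / 2) ^ d) = 1 - (1 / 2 :: real) ^ m" by (induction m) auto
    then show ?thesis by (simp add: sum_distrib_left[symmetric])
  qed
  also have "\<dots> < real (card \<Omega>) ^ t * 1"
    using n by (intro mult_strict_left_mono) (auto simp: card\<Omega>)
  finally have "(\<Sum>p\<in>(\<Union>d\<in>{1..m}. P d). card (E p) ^ t) < card \<Omega> ^ t"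
    by (simp flip: of_nat_power del: of_nat_sum)
  then obtain qs where qs: "set qs \<subseteq> \<Omega>" "length qs = t" "\<forall>p\<in>(\<Union>d\<in>{1..m}. P d). \<not> set qs \<subseteq> E p"
    using exists_list_avoiding[OF fin\<Omega>, of "\<Union>d\<in>{1..m}. P d" E t] finP
    by (fastforce simp: E_def \<Omega>_def)
  \<comment> \<open>Repeated samples and the intersection with \<open>R\<close> only shrink a query,
    so each has at most \<open>a\<close> elements.\<close>
  define Qs where "Qs = map (\<lambda>(xs, R). set xs \<inter> R) qs"
  have "Q \<subseteq> U \<and> card Q \<le> a" if Q: "Q \<in> set Qs" for Q
  proof -
    obtain xs R where xR: "(xs, R) \<in> set qs" "Q = set xs \<inter> R" using Q by (auto simp: Qs_def)
    then have "set xs \<subseteq> U" "length xs = a" using qs(1) by (auto simp: \<Omega>_def)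
    moreover have "card Q \<le> card (set xs)" unfolding xR(2) by (intro card_mono) auto
    moreover note card_length[of xs]
    ultimately show ?thesis using xR(2) by auto
  qed
  moreover have "\<exists>Q\<in>set Qs. card (Q \<inter> A) \<noteq> card (Q \<inter> B)"
    if AB: "A \<inter> B = {}" "A \<union> B \<subseteq> U" "A \<union> B \<noteq> {}" "card (A \<union> B) \<le> m" for A B
  proof -
    have "card (A \<union> B) \<ge> 1" using AB finite_subset[OF AB(2) assms(1)]
      by (metis One_nat_def Suc_leI card_gt_0_iff)
    then have "(A, B) \<in> (\<Union>d\<in>{1..m}. P d)" using AB by (auto simp: P_def)
    then have "\<not> set qs \<subseteq> E (A, B)" using qs(3) by blast
    then obtain xs R where xR: "(xs, R) \<in> set qs" "(xs, R) \<notin> E (A, B)" by auto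
    then have "card (set xs \<inter> R \<inter> A) \<noteq> card (set xs \<inter> R \<inter> B)"
      using qs(1) by (auto simp: E_def \<Omega>_def)
    moreover have "set xs \<inter> R \<in> set Qs" using xR(1) by (force simp: Qs_def)
    ultimately show ?thesis by blast
  qed
  ultimately show ?thesis using qs(2) by (intro exI[of _ Qs]) (auto simp: Qs_def)
qed

section \<open>From separation to group testing\<close>

text \<open>Queries of size at most \<open>\<alpha>\<close> never exceed the cap, so feedback is the
  exact count. The common part of \<open>K\<close> and \<open>L\<close> adds equally to both counts,
  which leaves the disjoint sets \<open>K - L\<close> and \<open>L - K\<close>, of total size at
  most \<open>2 * k\<close>.\<close>

lemma solves_group_testing_if_separating:
  assumes sub: "\<forall>Q\<in>set Qs. Q \<subseteq> {1..n} \<and> card Q \<le> \<alpha>"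
    and sep: "\<forall>A B. A \<inter> B = {} \<and> A \<union> B \<subseteq> {1..n} \<and> A \<union> B \<noteq> {} \<and> card (A \<union> B) \<le> 2 * k \<longrightarrow>
       (\<exists>Q\<in>set Qs. card (Q \<inter> A) \<noteq> card (Q \<inter> B))"
  shows "solves_group_testing n k \<alpha> Qs"
  unfolding solves_group_testing_def
proof (intro allI impI notI)
  fix K L assume KL: "K \<subseteq> {1..n} \<and> L \<subseteq> {1..n} \<and> card K \<le> k \<and> card L \<le> k \<and> K \<noteq> L"
    and eq: "feedback_vector \<alpha> Qs K = feedback_vector \<alpha> Qs L"
  have fin: "finite K" "finite L" using KL finite_subset by blast+
  have "card ((K - L) \<union> (L - K)) \<le> card (K \<union> L)" using fin by (intro card_mono) auto
  also have "\<dots> \<le> 2 * k" using card_Un_le[of K L] KL by linarith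
  finally have "card ((K - L) \<union> (L - K)) \<le> 2 * k" .
  then obtain Q where Q: "Q \<in> set Qs" "card (Q \<inter> (K - L)) \<noteq> card (Q \<inter> (L - K))"
    using sep[rule_format, of "K - L" "L - K"] KL by blast
  have finQ: "finite Q" using sub Q(1) finite_subset[of Q "{1..n}"] by blast
  have split: "card (Q \<inter> X) = card (Q \<inter> (X - Y)) + card (Q \<inter> X \<inter> Y)" for X Y
    by (subst card_Un_disjoint[symmetric]) (use finQ in \<open>auto intro: arg_cong[where f=card]\<close>)
  have cap: "capped_feedback \<alpha> (Q \<inter> X) = card (Q \<inter> X)" for X
    using card_mono[OF finQ, of "Q \<inter> X"] sub Q(1) by (fastforce simp: capped_feedback_def)
  have "card (Q \<inter> K) = card (Q \<inter> L)"
    using eq Q(1) cap by (auto simp: feedback_vector_def)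
  moreover have "Q \<inter> K \<inter> L = Q \<inter> L \<inter> K" by blast
  ultimately show False using Q(2) split[of K L] split[of L K] by simp
qed

text \<open>Any \<open>x\<close> in \<open>A \<union> B\<close> lies in exactly one of the two sets,
  so the query \<open>{x}\<close> counts 1 against 0.\<close>

lemma singletons_solve_group_testing:
  assumes "1 \<le> \<alpha>"
  shows "solves_group_testing n k \<alpha> (map (\<lambda>i. {i}) [1..<Suc n])"
proof (rule solves_group_testing_if_separating)
  show "\<forall>A B. A \<inter> B = {} \<and> A \<union> B \<subseteq> {1..n} \<and> A \<union> B \<noteq> {} \<and> card (A \<union> B) \<le> 2 * k \<longrightarrow>
       (\<exists>Q\<in>set (map (\<lambda>i. {i}) [1..<Suc n]). card (Q \<inter> A) \<noteq> card (Q \<inter> B))"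
  proof (intro allI impI)
    fix A B assume AB: "A \<inter> B = {} \<and> A \<union> B \<subseteq> {1..n} \<and> A \<union> B \<noteq> {} \<and> card (A \<union> B) \<le> 2 * k"
    then obtain x where x: "x \<in> A \<union> B" by blast
    then have "card ({x} \<inter> A) \<noteq> card ({x} \<inter> B)" using AB by (cases "x \<in> A") (auto simp: Int_insert_left)
    moreover have "{x} \<in> set (map (\<lambda>i. {i}) [1..<Suc n])" using x AB by (auto simp del: upt_Suc simp: image_iff)
    ultimately show "\<exists>Q\<in>set (map (\<lambda>i. {i}) [1..<Suc n]). card (Q \<inter> A) \<noteq> card (Q \<inter> B)" by blast
  qed
qed (use assms in auto)

section \<open>Constants and the final bound\<close>

lemma exists_random_solution:
  assumes "2 \<le> n" "1 \<le> \<alpha>" "\<alpha> \<le> k"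
  shows "\<exists>Qs. (\<forall>Q \<in> set Qs. Q \<subseteq> {1..n}) \<and>
    real (length Qs) \<le> 13 * ((real k + real n / real \<alpha>) * log 2 (real n)) \<and>
    solves_group_testing n k \<alpha> Qs"
proof -
  define v where "v = (real k + real n / real \<alpha>) * log 2 (real n)"
  define s where "s = 12 * v"
  define t where "t = nat \<lceil>s\<rceil>"
  have log1: "log 2 (real n) \<ge> 1" using assms by (subst le_log_iff) auto
  \<comment> \<open>Rounding \<open>s = 12 * v\<close> up costs less than 1, which
    \<open>1 \<le> v\<close> absorbs into \<open>13 * v\<close>.\<close>
  have "1 * 1 \<le> (real k + real n / real \<alpha>) * log 2 (real n)"
    using assms log1 by (intro mult_mono) (auto intro: add_increasing2)
  then have "1 \<le> v" by (simp add: v_def)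
  then have t_le: "real t \<le> 13 * v" unfolding t_def s_def by linarith
  \<comment> \<open>Passing to base 2 gives \<open>2 + log 2 n\<close>, and \<open>n \<ge> 2\<close>
    makes this at most \<open>3 * log 2 n\<close>.\<close>
  have "ln (4 * real n) \<le> ln (4 * real n) / ln 2"
    using assms ln_2_less_1 by (subst pos_le_divide_eq) (auto intro: mult_left_le)
  also have "\<dots> = log 2 4 + log 2 (real n)"
    using assms by (simp add: log_def ln_mult add_divide_distrib)
  also have "log 2 4 = (2 :: real)" using log_pow_cancel[of 2 2] by simp
  finally have ln_le: "ln (4 * real n) \<le> 3 * log 2 (real n)" using log1 by linarith
  \<comment> \<open>The constant 12 is 4 from
    \<open>2 (n/\<alpha> + 2 k) \<le> 4 (k + n/\<alpha>)\<close> times 3 from the change of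
    logarithm.\<close>
  have "2 * (real n / real \<alpha> + real (2 * k)) * ln (4 * real n)
      \<le> 2 * (2 * (real k + real n / real \<alpha>)) * (3 * log 2 (real n))"
    using assms ln_le by (intro mult_mono) (auto intro: divide_right_mono)
  also have "\<dots> = s" by (simp add: s_def v_def)
  also have "\<dots> \<le> real t" unfolding t_def by linarith
  finally obtain Qs where Qs: "length Qs = t" "\<forall>Q\<in>set Qs. Q \<subseteq> {1..n} \<and> card Q \<le> \<alpha>"
    "\<forall>A B. A \<inter> B = {} \<and> A \<union> B \<subseteq> {1..n} \<and> A \<union> B \<noteq> {} \<and> card (A \<union> B) \<le> 2 * k \<longrightarrow>
       (\<exists>Q\<in>set Qs. card (Q \<inter> A) \<noteq> card (Q \<inter> B))"
    using exists_separating_queries[of "{1..n}" \<alpha> "2 * k" t] assms by auto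
  then show ?thesis
    using solves_group_testing_if_separating[OF Qs(2,3)] t_le Qs(1) unfolding v_def by blast
qed

theorem theorem3:
  "\<exists>C::real. C > 0 \<and>
    (\<forall>n k \<alpha> :: nat. 2 \<le> n \<and> 1 \<le> \<alpha> \<and> \<alpha> \<le> k \<and> k \<le> n \<longrightarrow>
      (\<exists>Qs :: nat set list.
        (\<forall>Q \<in> set Qs. Q \<subseteq> {1..n}) \<and>
        real (length Qs) \<le> C * min (real n) ((real k + real n / real \<alpha>) * log 2 (real n)) \<and>
        solves_group_testing n k \<alpha> Qs))"
\<comment> \<open>The constant 13 comes from the random construction; the \<open>n\<close>
  singletons fit under it with room to spare.\<close>
proof (intro exI[of _ 13] conjI allI impI)
  fix n k \<alpha> :: nat
  assume asm: "2 \<le> n \<and> 1 \<le> \<alpha> \<and> \<alpha> \<le> k \<and> k \<le> n"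
  show "\<exists>Qs. (\<forall>Q \<in> set Qs. Q \<subseteq> {1..n}) \<and>
      real (length Qs) \<le> 13 * min (real n) ((real k + real n / real \<alpha>) * log 2 (real n)) \<and>
      solves_group_testing n k \<alpha> Qs"
  proof (cases "real n \<le> (real k + real n / real \<alpha>) * log 2 (real n)")
    case True
    then show ?thesis using asm singletons_solve_group_testing[of \<alpha> n k]
      by (intro exI[of _ "map (\<lambda>i. {i}) [1..<Suc n]"]) (auto simp: min_def)
  next
    case False
    then show ?thesis using exists_random_solution[of n \<alpha> k] asm by (simp add: min_def)
  qed
qed simp

end
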